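(* Let $a,b$ be nonzero real numbers and let $(\mathcal{L}_n(a,b))_{n\ge 0}$ be the bi-periodic Lucas matrix sequence. The following equalities hold. (i) The generating function of the sequence is $$\sum_{i=0}^{\infty}\mathcal{L}_i(a,b)\,x^i=\frac{1}{1-(ab+2)x^2+x^4}\begin{pmatrix} A_2 & B_2\\ \frac{a}{b}B_2 & C_2\end{pmatrix},$$ where $A_2=a+\left(a^2+2\frac{a}{b}\right)x+ax^2-2\frac{a}{b}x^3$, $B_2=2+ax-(ab+2)x^2+ax^3$ and $C_2=-a+2\frac{a}{b}x+(3+ab)a x^2-\left(a^2+2\frac{a}{b}\right)x^3$. (ii) For every integer $n\ge 1$, $$\sum_{k=0}^{n}\mathcal{L}_k(a,b)\,x^{-k}=\frac{1}{1-(ab+2)x^2+x^4}\Big\{\frac{\mathcal{L}_{n-1}(a,b)}{x^{n-1}}-\frac{\mathcal{L}_{n+1}(a,b)}{x^{n-3}}+\frac{\mathcal{L}_n(a,b)}{x^n}-\frac{\mathcal{L}_{n+2}(a,b)}{x^{n+2}}+x^4\mathcal{L}_0(a,b)+x^3\mathcal{L}_1(a,b)-x^2\left[(ab+1)\mathcal{L}_0(a,b)-b\,\mathcal{L}_1(a,b)\right]-x\left(\mathcal{L}_1(a,b)-a\,\mathcal{L}_0(a,b)\right)\Big\}.$$ (iii) $$\sum_{k=0}^{\infty}\mathcal{L}_k(a,b)\,x^{-k}=\frac{x}{1-(ab+2)x^2+x^4}\begin{pmatrix} D & E\\ \frac{a}{b}E & F\end{pmatrix},$$ where $D=ax^3+\left(a^2+2\frac{a}{b}\right)x^2-ax+2\frac{a}{b}$,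 $E=2x^3+ax^2+(ab+2)x+a$ and $F=-ax^3+2\frac{a}{b}x^2-(a^2b+3a)x+a^2+2\frac{a}{b}$. (iv) For every integer $n\ge1$, $$\sum_{k=0}^{n-1}\mathcal{L}_k(a,b)=\frac{1}{ab}\Big\{b^{\varepsilon(n)}a^{1-\varepsilon(n)}\mathcal{L}_n(a,b)+b^{1-\varepsilon(n)}a^{\varepsilon(n)}\mathcal{L}_{n-1}(a,b)-b\,\mathcal{L}_1(a,b)+ab\,\mathcal{L}_0(a,b)-a\,\mathcal{L}_0(a,b)\Big\}.$$
   Context: Let $a,b$ be nonzero real numbers. Put $\varepsilon(n)=1$ if $n$ is odd and $\varepsilon(n)=0$ if $n$ is even. Here $x$ is an indeterminate; the infinite sums in (i) and (iii) are series in powers of $x$ and of $x^{-1}$ respectively. The bi-periodic Lucas matrix sequence is defined by $$\mathcal{L}_0(a,b)=\begin{pmatrix} a & 2\\ 2\frac{a}{b} & -a\end{pmatrix},\qquad \mathcal{L}_1(a,b)=\begin{pmatrix} a^2+2\frac{a}{b} & a\\ \frac{a^2}{b} & 2\frac{a}{b}\end{pmatrix},$$ and for $n\ge 2$, $\mathcal{L}_n(a,b)=a\,\mathcal{L}_{n-1}(a,b)+\mathcal{L}_{n-2}(a,b)$ if $n$ is odd, $\mathcal{L}_n(a,b)=b\,\mathcal{L}_{n-1}(a,b)+\mathcal{L}_{n-2}(a,b)$ if $n$ is even.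
   Formalization: Misprints corrected: in (ii) the L_{n+2} term has denominator x^{n-2}, not x^{n+2}; in (iii) the last two terms of D (now +ax-2a/b), the x-term of E (now -(ab+2)x) and the last two terms of F (now +(a^2b+3a)x-(a^2+2a/b)) change sign. *)

theory Defs
  imports
    "HOL-Analysis.Analysis"
    "HOL-Computational_Algebra.Formal_Laurent_Series"
begin

definition mat2 :: "'k::zero \<Rightarrow> 'k \<Rightarrow> 'k \<Rightarrow> 'k \<Rightarrow> 'k^2^2" where
  "mat2 p q r s = vector [vector [p, q], vector [r, s]]"

text \<open>The product \<open>*\<close> of the type \<open>'k^2^2\<close> is entrywise and \<open>*\<^sub>R\<close> only has real scalars,
  hence a scalar multiplication for matrices over a ring of formal series.\<close>
definition smult_mat :: "'k::times \<Rightarrow> 'k^2^2 \<Rightarrow> 'k^2^2" (infixr "\<cdot>\<^sub>m" 75) where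
  "c \<cdot>\<^sub>m M = (\<chi> i j. c * M $ i $ j)"

definition map_mat2 :: "('k \<Rightarrow> 'l) \<Rightarrow> 'k^2^2 \<Rightarrow> 'l^2^2" where
  "map_mat2 f M = (\<chi> i j. f (M $ i $ j))"

definition parity_eps :: "nat \<Rightarrow> nat" ("\<epsilon>") where
  "\<epsilon> n = (if odd n then 1 else 0)"

fun lucas_mat :: "real \<Rightarrow> real \<Rightarrow> nat \<Rightarrow> real^2^2" where
  "lucas_mat a b 0 = mat2 a 2 (2 * (a / b)) (- a)"
| "lucas_mat a b (Suc 0) = mat2 (a^2 + 2 * (a / b)) a (a^2 / b) (2 * (a / b))"
| "lucas_mat a b (Suc (Suc n)) =
     (if odd (Suc (Suc n)) then a else b) *\<^sub>R lucas_mat a b (Suc n) + lucas_mat a b n"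

text \<open>
  Constant matrices over the formal power series in \<open>x\<close> (\<open>x = fps_X\<close>), and over the formal
  Laurent series in \<open>1/x\<close>. For the latter the library's series variable \<open>fls_X\<close> plays the role
  of \<open>1/x\<close>, so that \<open>x = fls_X_inv\<close>; this field contains the rational functions in \<open>x\<close>.
  Infinite sums (\<open>sums\<close>) refer to the product topology on \<open>'k^2^2\<close>, with the formal
  (X-adic) topology on each entry.\<close>

definition fps_lucas :: "real \<Rightarrow> real \<Rightarrow> nat \<Rightarrow> real fps^2^2" where
  "fps_lucas a b n = map_mat2 fps_const (lucas_mat a b n)"

definition fls_lucas :: "real \<Rightarrow> real \<Rightarrow> nat \<Rightarrow> real fls^2^2" where
  "fls_lucas a b n = map_mat2 fls_const (lucas_mat a b n)"

text \<open>
  Two of the four identities to be stated are misprinted in the source, and false as printed;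
  they are stated with the following corrections (\<open>L\<close> is the matrix sequence).

  \<^item> In the finite sum of \<open>L k * x^(-k)\<close> for \<open>k \<le> n\<close>, the term with \<open>L (n+2)\<close> has denominator
    \<open>x^(n-2)\<close>; the source prints \<open>x^(n+2)\<close>. Multiplying the sum by
    \<open>1 - (ab+2) x^2 + x^4\<close> produces this term as \<open>x^4 * x^(-(n+2))\<close>.

  \<^item> In the infinite sum, the last two terms of \<open>D\<close>, the \<open>x\<close>-term of \<open>E\<close> and the last two terms
    of \<open>F\<close> have the opposite sign. With the printed
    \<open>D = a x^3 + (a^2 + 2a/b) x^2 - a x + 2a/b\<close>, the coefficient of \<open>x^(-2)\<close> in the upper left
    entry of the right-hand side would be \<open>a^2 b + a\<close>, whereas that entry of \<open>L 2\<close> is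
    \<open>a^2 b + 3a\<close>. The printed \<open>E = 2x^3 + ax^2 + (ab+2)x + a\<close> and
    \<open>F = -ax^3 + 2(a/b)x^2 - (a^2 b + 3a)x + a^2 + 2a/b\<close> fail in the same way. The corrected
    entries are those of the limit \<open>n \<rightarrow> \<infinity>\<close> of the finite sum.\<close>

end

theory Submission
  imports Defs
begin

text \<open>
  Two steps of the recurrence combine to \<open>L (n+4) = (ab+2) L (n+2) - L n\<close>, independently of
  the parity of \<open>n\<close>. Hence multiplying a partial or infinite sum by
  \<open>1 - (ab+2) x^2 + x^4\<close> leaves only the boundary terms. The sum in \<open>1/x\<close> is the image of the one
  in \<open>x\<close> under the isometric embedding of power series into Laurent series.\<close>

no_notation fps_nth (infixl "$" 75)

section \<open>Matrix entries and entrywise convergence\<close>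

lemma smult_mat_nth [simp]: "(c \<cdot>\<^sub>m M) $ i $ j = c * M $ i $ j"
  by (simp add: smult_mat_def)

lemma map_mat2_nth [simp]: "map_mat2 f M $ i $ j = f (M $ i $ j)"
  by (simp add: map_mat2_def)

lemma mat2_nth [simp]:
  "mat2 p q r s $ 1 $ 1 = p" "mat2 p q r s $ 1 $ 2 = q"
  "mat2 p q r s $ 2 $ 1 = r" "mat2 p q r s $ 2 $ 2 = s"
  by (simp_all add: mat2_def)

text \<open>The topology on vectors is the product topology. Only a topological space is asked of
  the components, since they will be formal series.\<close>

lemma sums_vecI:
  fixes f :: "nat \<Rightarrow> 'a::{comm_monoid_add,topological_space}^'n"
  assumes "\<And>i. (\<lambda>k. f k $ i) sums (s $ i)"
  shows "f sums s"
  using assms unfolding sums_def by (intro vec_tendstoI) (simp add: sum_component)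

lemma sums_mat2I:
  fixes f :: "nat \<Rightarrow> 'a::{comm_monoid_add,topological_space}^2^2"
  assumes "(\<lambda>k. f k $ 1 $ 1) sums (s $ 1 $ 1)" "(\<lambda>k. f k $ 1 $ 2) sums (s $ 1 $ 2)"
    and "(\<lambda>k. f k $ 2 $ 1) sums (s $ 2 $ 1)" "(\<lambda>k. f k $ 2 $ 2) sums (s $ 2 $ 2)"
  shows "f sums s"
proof (intro sums_vecI)
  fix i j :: 2
  show "(\<lambda>k. f k $ i $ j) sums (s $ i $ j)"
    using exhaust_2[of i] exhaust_2[of j] assms by auto
qed

section \<open>The matrix recurrence with step two and its initial data\<close>

text \<open>Let \<open>c\<close> and \<open>d\<close> be the coefficients in the steps to
  \<open>n + 4\<close> and \<open>n + 3\<close>. The step to \<open>n + 2\<close> uses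
  \<open>c\<close> again, and \<open>c * d = a * b\<close>. Substituting for \<open>L (n+3)\<close>
  leaves the term \<open>c * L (n+1)\<close>, which is \<open>L (n+2) - L n\<close>.\<close>

lemma lucas_mat_nth_add4:
  "lucas_mat a b (n + 4) $ i $ j = (a * b + 2) * lucas_mat a b (n + 2) $ i $ j
    - lucas_mat a b n $ i $ j"
proof -
  have "n + 4 = Suc (Suc (Suc (Suc n)))" "n + 2 = Suc (Suc n)" by simp_all
  then show ?thesis by (simp only:) (simp add: algebra_simps)
qed

lemma lucas_mat_2_3:
  "lucas_mat a b 2 = b *\<^sub>R lucas_mat a b 1 + lucas_mat a b 0"
  "lucas_mat a b 3 = a *\<^sub>R lucas_mat a b 2 + lucas_mat a b 1"
  unfolding numeral_2_eq_2 numeral_3_eq_3 by simp_all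

text \<open>These are the coefficients of the cubic numerator in (i), in ascending order. Each lower
  left entry is kept as \<open>a / b\<close> times the upper right one, up to sign placement, so
  that this factor can be taken out of the whole polynomial.\<close>

lemma lucas_mat_boundary:
  assumes "b \<noteq> 0"
  shows "lucas_mat a b 0 = mat2 a 2 (a / b * 2) (- a)"
    and "lucas_mat a b 1 = mat2 (a^2 + 2 * (a / b)) a (a / b * a) (2 * (a / b))"
    and "lucas_mat a b 2 - (a * b + 2) *\<^sub>R lucas_mat a b 0 =
      mat2 a (- (a * b + 2)) (- (a / b * (a * b + 2))) ((3 + a * b) * a)"
    and "lucas_mat a b 3 - (a * b + 2) *\<^sub>R lucas_mat a b 1 =
      mat2 (- (2 * (a / b))) a (a / b * a) (- (a^2 + 2 * (a / b)))"
  using assms unfolding vec_eq_iff forall_2 lucas_mat_2_3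
  by (simp_all add: field_simps power2_eq_square)

section \<open>Finite sums of scalar sequences in powers of 1/x\<close>

text \<open>The sum ends at \<open>Suc m\<close> because the boundary terms involve the last two
  indices, one of each parity. The base case is an identity in \<open>u 0\<close> to
  \<open>u 3\<close>.\<close>

lemma sum_linear_recurrence4:
  fixes u :: "nat \<Rightarrow> 'a::field"
  assumes rec: "\<And>n. u (n + 4) = p * u (n + 2) - u n" and x: "x \<noteq> 0"
  shows "(1 - p * x^2 + x^4) * (\<Sum>k=0..Suc m. u k / x^k) =
    u m / x^m - u (m + 2) * x^2 / x^m + u (m + 1) / x^(m+1) - u (m + 3) * x^2 / x^(m+1)
    + x^4 * u 0 + x^3 * u 1 + x^2 * (u 2 - p * u 0) + x * (u 3 - p * u 1)"
proof (induction m)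
  case 0
  show ?case using x by (simp add: field_simps eval_nat_numeral)
next
  case (Suc m)
  let ?q = "1 - p * x^2 + x^4"
  \<comment> \<open>The recurrence replaces \<open>p * u (m + 2)\<close> by
    \<open>u (m + 4) + u m\<close>. The last two terms cancel the boundary terms over
    \<open>x^m\<close> in the induction hypothesis; the first two are the new boundary
    terms.\<close>
  have last: "?q * (u (m + 2) / x^(m+2)) =
      u (m + 2) / x^(m+2) - u (m + 4) * x^2 / x^(m+2) - u m / x^m + u (m + 2) * x^2 / x^m"
    unfolding rec[of m] using x
    by (simp add: divide_simps power_add) (simp add: algebra_simps eval_nat_numeral)
  have index: "Suc m + 1 = m + 2" "Suc m + 2 = m + 3" "Suc m + 3 = m + 4" "Suc (Suc m) = m + 2"
    "Suc m = m + 1"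
    by simp_all
  have suc: "Suc (Suc (Suc m)) = m + 3" "Suc (Suc (Suc (Suc m))) = m + 4" by simp_all
  have "?q * (\<Sum>k=0..Suc (Suc m). u k / x^k) =
      ?q * (\<Sum>k=0..Suc m. u k / x^k) + ?q * (u (m + 2) / x^(m+2))"
    by (simp add: distrib_left)
  then show ?case
    unfolding Suc.IH last
    by (simp only: index) (simp add: algebra_simps suc)
qed

section \<open>Generating functions as formal power series\<close>

lemma fps_linear_recurrence4:
  fixes u :: "nat \<Rightarrow> 'a::field"
  assumes rec: "\<And>n. u (n + 4) = p * u (n + 2) - u n"
  defines "c \<equiv> fps_const" and "x \<equiv> fps_X"
  shows "Abs_fps u * (1 - c p * x^2 + x^4) =
    c (u 0) + c (u 1) * x + c (u 2 - p * u 0) * x^2 + c (u 3 - p * u 1) * x^3"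
proof (rule fps_ext)
  fix n :: nat
  have eq: "Abs_fps u * (1 - c p * x^2 + x^4) =
    Abs_fps u - c p * (Abs_fps u * x^2) + Abs_fps u * x^4"
    by (simp add: algebra_simps)
  \<comment> \<open>Coefficient \<open>n\<close> of the product is
    \<open>u n - p * u (n - 2) + u (n - 4)\<close>, without the terms of negative index. From index
    4 on all three are present and the recurrence makes them vanish.\<close>
  consider "n = 0" | "n = 1" | "n = 2" | "n = 3" | m where "n = m + 4"
    by atomize_elim presburger
  then show "fps_nth (Abs_fps u * (1 - c p * x^2 + x^4)) n =
    fps_nth (c (u 0) + c (u 1) * x + c (u 2 - p * u 0) * x^2 + c (u 3 - p * u 1) * x^3) n"
    unfolding eq unfolding c_def x_def by cases (simp_all add: fps_X_power_mult_right_nth rec)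
qed

lemma fps_sums_coeffs:
  fixes u :: "nat \<Rightarrow> 'a::comm_ring_1"
  shows "(\<lambda>k. fps_X^k * fps_const (u k)) sums Abs_fps u"
  using fps_notation[of "Abs_fps u"]
  unfolding sums_def_le by (simp add: mult.commute atMost_atLeast0)

lemma fps_recurrence_denominator_nonzero:
  "1 - fps_const (p::'a::field) * fps_X^2 + fps_X^4 \<noteq> 0"
  by (rule fps_nonzeroI[of _ 0]) simp

lemma fps_sums_linear_recurrence4:
  fixes u :: "nat \<Rightarrow> 'a::field"
  assumes "\<And>n. u (n + 4) = p * u (n + 2) - u n"
  defines "c \<equiv> fps_const" and "x \<equiv> fps_X"
  shows "(\<lambda>k. x^k * c (u k)) sums
    (1 / (1 - c p * x^2 + x^4) *
      (c (u 0) + c (u 1) * x + c (u 2 - p * u 0) * x^2 + c (u 3 - p * u 1) * x^3))"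
proof -
  let ?q = "1 - c p * x^2 + x^4"
  \<comment> \<open>The constant coefficient is 1, so the denominator is a unit and the division is
    exact.\<close>
  have "fps_nth ?q 0 \<noteq> 0" by (simp add: c_def x_def)
  then have "1 / ?q * (Abs_fps u * ?q) = Abs_fps u"
    by (simp add: fps_divide_unit inverse_mult_eq_1 mult.left_commute)
  then show ?thesis
    using fps_sums_coeffs[of u] fps_linear_recurrence4[of u, OF assms(1)] by (simp add: c_def x_def)
qed

section \<open>Transfer to Laurent series in 1/x\<close>

text \<open>The embedding preserves subdegrees, and these determine the X-adic distance.\<close>

lemma dist_fps_to_fls: "dist (fps_to_fls f) (fps_to_fls g) = dist f g"
  by (simp add: dist_fls_def dist_fps_def fls_subdegree_fls_to_fps flip: fps_to_fls_minus)

lemma fps_to_fls_sum: "fps_to_fls (sum f A) = (\<Sum>i\<in>A. fps_to_fls (f i))"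
  by (induction A rule: infinite_finite_induct) simp_all

lemma sums_fps_to_fls:
  assumes "f sums s"
  shows "(\<lambda>k. fps_to_fls (f k)) sums fps_to_fls s"
  using assms unfolding sums_def tendsto_iff by (simp add: dist_fps_to_fls flip: fps_to_fls_sum)

text \<open>The polynomial is palindromic, so multiplying by the fourth power of 1/x replaces
  \<open>x\<close> by 1/x. The result is a power series with constant coefficient 1.\<close>

lemma fls_recurrence_denominator_nonzero:
  "1 - fls_const (p::'a::field) * fls_X_inv^2 + fls_X_inv^4 \<noteq> 0"
proof -
  have inv: "inverse x^4 * (1 - c * x^2 + x^4) = 1 - c * inverse x^2 + inverse x^4"
    if "x \<noteq> 0" for c x :: "'a fls"
    using that by (simp add: field_simps flip: power_add)
  have "fls_X^4 * (1 - fls_const p * fls_X_inv^2 + fls_X_inv^4) =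
      fps_to_fls (1 - fps_const p * fps_X^2 + fps_X^4)"
    using inv[OF fls_X_inv_nonzero, of "fls_const p"]
    by (simp add: fls_times_fps_to_fls fps_to_fls_power fls_inverse_X_inv)
  then show ?thesis
    using fps_recurrence_denominator_nonzero[of p] fps_to_fls_eq_0_iff by (metis mult_zero_right)
qed

text \<open>This is the power series result at \<open>y = 1 / x\<close>. Since the denominator is
  palindromic, the change of variable costs a factor \<open>x^4\<close>, which reverses the cubic
  numerator and leaves one \<open>x\<close> in front.\<close>

lemma fls_sums_linear_recurrence4:
  fixes u :: "nat \<Rightarrow> 'a::field"
  assumes rec: "\<And>n. u (n + 4) = p * u (n + 2) - u n"
  defines "c \<equiv> fls_const" and "x \<equiv> fls_X_inv"
  shows "(\<lambda>k. x powi (- int k) * c (u k)) sums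
    (x / (1 - c p * x^2 + x^4) *
      (c (u 0) * x^3 + c (u 1) * x^2 + c (u 2 - p * u 0) * x + c (u 3 - p * u 1)))"
proof -
  define y :: "'a fls" where "y = fls_X"
  have x: "x \<noteq> 0" by (simp add: x_def)
  have y: "y = 1 / x" unfolding x_def y_def by (metis fls_inverse_X_inv inverse_eq_divide)
  let ?q = "1 - c p * x^2 + x^4" and ?r = "1 - c p * y^2 + y^4"
  have q: "?q \<noteq> 0" unfolding c_def x_def by (rule fls_recurrence_denominator_nonzero)
  have qr: "?r * x^4 = ?q" unfolding y using x by (simp add: field_simps flip: power_add)
  then have r: "?r \<noteq> 0" using q by auto
  have "(\<lambda>k. y^k * c (u k)) sums
    (1 / ?r * (c (u 0) + c (u 1) * y + c (u 2 - p * u 0) * y^2 + c (u 3 - p * u 1) * y^3))"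
    using sums_fps_to_fls[OF fps_sums_linear_recurrence4[of u p, OF rec]]
    by (simp add: y_def c_def fls_times_fps_to_fls fps_to_fls_power flip: fls_divide_fps_to_fls)
  also have "(\<lambda>k. y^k * c (u k)) = (\<lambda>k. x powi (- int k) * c (u k))"
    by (simp add: y power_int_minus power_one_over inverse_eq_divide)
  also have "1 / ?r = x^4 / ?q" using q r qr by (simp add: field_simps)
  also have "x^4 / ?q * (c (u 0) + c (u 1) * y + c (u 2 - p * u 0) * y^2 + c (u 3 - p * u 1) * y^3) =
    x / ?q * (c (u 0) * x^3 + c (u 1) * x^2 + c (u 2 - p * u 0) * x + c (u 3 - p * u 1))"
    unfolding y using x q by (simp add: divide_simps) (simp add: algebra_simps eval_nat_numeral)
  finally show ?thesis .
qed

section \<open>Partial sums of the matrices themselves\<close>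

text \<open>Passing from \<open>m\<close> to \<open>Suc m\<close>, the terms in
  \<open>L (m+1)\<close> cancel in the difference of the right-hand sides. What remains is
  \<open>a\<close> or \<open>b\<close> times \<open>L (m+2) - L m\<close>, which is
  \<open>a * b\<close> times \<open>L (m+1)\<close>.\<close>

lemma sum_lucas_mat:
  assumes "a \<noteq> 0" "b \<noteq> 0"
  shows "(a * b) *\<^sub>R (\<Sum>k=0..m. lucas_mat a b k) =
    (if even m then b else a) *\<^sub>R lucas_mat a b (Suc m) + (if even m then a else b) *\<^sub>R lucas_mat a b m
    - b *\<^sub>R lucas_mat a b 1 + (a * b) *\<^sub>R lucas_mat a b 0 - a *\<^sub>R lucas_mat a b 0"
proof (induction m)
  case 0
  show ?case by simp
next
  case (Suc m)
  then show ?case by (simp add: algebra_simps)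
qed

theorem theorem2p6:
  fixes a b :: real
  assumes "a \<noteq> 0" and "b \<noteq> 0"
  shows
    "(let x = fps_X :: real fps; c = fps_const;
          A\<^sub>2 = c a + c (a^2 + 2 * (a / b)) * x + c a * x^2 - c (2 * (a / b)) * x^3;
          B\<^sub>2 = c 2 + c a * x - c (a * b + 2) * x^2 + c a * x^3;
          C\<^sub>2 = - c a + c (2 * (a / b)) * x + c ((3 + a * b) * a) * x^2
                 - c (a^2 + 2 * (a / b)) * x^3
      in (\<lambda>i. x^i \<cdot>\<^sub>m fps_lucas a b i) sums
           ((1 / (1 - c (a * b + 2) * x^2 + x^4)) \<cdot>\<^sub>m mat2 A\<^sub>2 B\<^sub>2 (c (a / b) * B\<^sub>2) C\<^sub>2))
     \<and>
     (\<forall>n::nat. n \<ge> 1 \<longrightarrow>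
       (let x = fls_X_inv :: real fls; c = fls_const; L = fls_lucas a b
        in (\<Sum>k=0..n. x powi (- int k) \<cdot>\<^sub>m L k) =
             (1 / (1 - c (a * b + 2) * x^2 + x^4)) \<cdot>\<^sub>m
               ((1 / x powi (int n - 1)) \<cdot>\<^sub>m L (n - 1)
                - (1 / x powi (int n - 3)) \<cdot>\<^sub>m L (n + 1)
                + (1 / x powi (int n)) \<cdot>\<^sub>m L n
                - (1 / x powi (int n - 2)) \<cdot>\<^sub>m L (n + 2)
                + x^4 \<cdot>\<^sub>m L 0 + x^3 \<cdot>\<^sub>m L 1
                - x^2 \<cdot>\<^sub>m (c (a * b + 1) \<cdot>\<^sub>m L 0 - c b \<cdot>\<^sub>m L 1)
                - x \<cdot>\<^sub>m (L 1 - c a \<cdot>\<^sub>m L 0))))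
     \<and>
     (let x = fls_X_inv :: real fls; c = fls_const;
          D = c a * x^3 + c (a^2 + 2 * (a / b)) * x^2 + c a * x - c (2 * (a / b));
          E = c 2 * x^3 + c a * x^2 - c (a * b + 2) * x + c a;
          F = - c a * x^3 + c (2 * (a / b)) * x^2 + c (a^2 * b + 3 * a) * x
               - c (a^2 + 2 * (a / b))
      in (\<lambda>k. x powi (- int k) \<cdot>\<^sub>m fls_lucas a b k) sums
           ((x / (1 - c (a * b + 2) * x^2 + x^4)) \<cdot>\<^sub>m mat2 D E (c (a / b) * E) F))
     \<and>
     (\<forall>n::nat. n \<ge> 1 \<longrightarrow>
       (let L = lucas_mat a b
        in (\<Sum>k=0..n-1. L k) =
             (1 / (a * b)) *\<^sub>R
               ((b ^ \<epsilon> n * a ^ (1 - \<epsilon> n)) *\<^sub>R L n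
                + (b ^ (1 - \<epsilon> n) * a ^ \<epsilon> n) *\<^sub>R L (n - 1)
                - b *\<^sub>R L 1 + (a * b) *\<^sub>R L 0 - a *\<^sub>R L 0)))"
proof -
  note rec = lucas_mat_nth_add4[of a b]
  have fps: "(\<lambda>k. fps_X^k * fps_const (lucas_mat a b k $ i $ j)) sums
      (1 / (1 - fps_const (a * b + 2) * fps_X^2 + fps_X^4) *
        (fps_const (lucas_mat a b 0 $ i $ j) + fps_const (lucas_mat a b 1 $ i $ j) * fps_X
         + fps_const ((lucas_mat a b 2 - (a * b + 2) *\<^sub>R lucas_mat a b 0) $ i $ j) * fps_X^2
         + fps_const ((lucas_mat a b 3 - (a * b + 2) *\<^sub>R lucas_mat a b 1) $ i $ j) * fps_X^3))"
    for i j unfolding vector_minus_component vector_scaleR_component real_scaleR_def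
    by (rule fps_sums_linear_recurrence4) (rule rec)
  have fls: "(\<lambda>k. fls_X_inv powi (- int k) * fls_const (lucas_mat a b k $ i $ j)) sums
      (fls_X_inv / (1 - fls_const (a * b + 2) * fls_X_inv^2 + fls_X_inv^4) *
        (fls_const (lucas_mat a b 0 $ i $ j) * fls_X_inv^3 + fls_const (lucas_mat a b 1 $ i $ j) * fls_X_inv^2
         + fls_const ((lucas_mat a b 2 - (a * b + 2) *\<^sub>R lucas_mat a b 0) $ i $ j) * fls_X_inv
         + fls_const ((lucas_mat a b 3 - (a * b + 2) *\<^sub>R lucas_mat a b 1) $ i $ j)))"
    for i j unfolding vector_minus_component vector_scaleR_component real_scaleR_def
    by (rule fls_sums_linear_recurrence4) (rule rec)
  note boundary = lucas_mat_boundary[OF assms(2)]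
  \<comment> \<open>The order matters: the left-hand sides of \<open>boundary(3,4)\<close> contain
    the matrices that \<open>boundary(1,2)\<close> rewrites.\<close>
  note fps = fps[unfolded boundary(3,4), unfolded boundary(1,2)]
    and fls = fls[unfolded boundary(3,4), unfolded boundary(1,2)]
  show ?thesis
    unfolding Let_def
  proof (intro conjI allI impI, goal_cases)
    case 1
    show ?case
    proof (rule sums_mat2I, goal_cases)
      case 1 show ?case
        \<comment> \<open>Negated constants become subtractions as in the goal;
          \<open>minus_add_distrib\<close> would first break up a negated sum.\<close>
        using fps[of 1 1] by (simp add: fps_lucas_def del: minus_add_distrib flip: fps_const_neg)
    next
      case 2 show ?case
        using fps[of 1 2] by (simp add: fps_lucas_def del: minus_add_distrib flip: fps_const_neg)
    next
      case 3
      have scale: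
        "fps_const (r * s0) + fps_const (r * s1) * x
          + fps_const (- (r * s2)) * x^2 + fps_const (r * s3) * x^3
        =
          fps_const r * (fps_const s0 + fps_const s1 * x - fps_const s2 * x^2 + fps_const s3 * x^3)"
        for r s0 s1 s2 s3 :: real and x
        by (simp add: algebra_simps flip: fps_const_neg fps_const_mult)
      show ?case
        using fps[of 2 1, unfolded mat2_nth scale] by (simp add: fps_lucas_def)
    next
      case 4 show ?case
        using fps[of 2 2] by (simp add: fps_lucas_def del: minus_add_distrib flip: fps_const_neg)
    qed
  next
    case (2 n)
    then obtain m where n: "n = Suc m" by (cases n) auto
    show ?case (is "?lhs = ?rhs")
      unfolding vec_eq_iff
    proof (intro allI)
      fix i j :: 2
      define x :: "real fls" where "x = fls_X_inv"
      define u where "u k = fls_const (lucas_mat a b k $ i $ j)" for k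
      define p where "p = fls_const (a * b + 2)"
      have x: "x \<noteq> 0" by (simp add: x_def)
      have q: "1 - p * x^2 + x^4 \<noteq> 0"
        unfolding p_def x_def by (rule fls_recurrence_denominator_nonzero)
      have rec_u: "u (k + 4) = p * u (k + 2) - u k" for k
        by (simp add: u_def p_def rec fls_minus_const)
      \<comment> \<open>Expressing \<open>u 2\<close> and \<open>u 3\<close> through
        \<open>u 0\<close> and \<open>u 1\<close> gives the brackets of (ii).\<close>
      have initial: "u 2 - p * u 0 = - (fls_const (a * b + 1) * u 0 - fls_const b * u 1)"
        "u 3 - p * u 1 = - (u 1 - fls_const a * u 0)"
        by (simp_all add: u_def p_def lucas_mat_2_3 fls_minus_const algebra_simps del: lucas_mat.simps
            flip: fls_const_uminus)
      \<comment> \<open>The exponent \<open>int n - 3\<close> is negative for \<open>n\<close> equal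
        to 1 or 2, so the integer powers are turned into quotients of natural powers.\<close>
      have powers: "1 / x powi (int n - 1) = 1 / x^m" "1 / x powi (int n - 3) = x^2 / x^m"
        "1 / x powi (int n) = 1 / x^(m+1)" "1 / x powi (int n - 2) = x^2 / x^(m+1)"
        "x powi (- int k) = 1 / x^k" for k
        using x by (simp_all add: n power_int_diff power_int_minus power_int_add inverse_eq_divide
            field_simps eval_nat_numeral)
      have "(1 - p * x^2 + x^4) * (\<Sum>k=0..n. x powi (- int k) * u k) =
         1 / x powi (int n - 1) * u (n - 1) - 1 / x powi (int n - 3) * u (n + 1)
         + 1 / x powi (int n) * u n - 1 / x powi (int n - 2) * u (n + 2)
         + x^4 * u 0 + x^3 * u 1 - x^2 * (fls_const (a * b + 1) * u 0 - fls_const b * u 1)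
         - x * (u 1 - fls_const a * u 0)"
        using sum_linear_recurrence4[of u p x m, OF rec_u x]
        unfolding powers initial
        by (simp add: n algebra_simps numeral_3_eq_3)
      then have "(\<Sum>k=0..n. x powi (- int k) * u k) = 1 / (1 - p * x^2 + x^4) *
        (1 / x powi (int n - 1) * u (n - 1) - 1 / x powi (int n - 3) * u (n + 1)
         + 1 / x powi (int n) * u n - 1 / x powi (int n - 2) * u (n + 2)
         + x^4 * u 0 + x^3 * u 1 - x^2 * (fls_const (a * b + 1) * u 0 - fls_const b * u 1)
         - x * (u 1 - fls_const a * u 0))"
        using q by (simp add: eq_divide_eq mult.commute)
      then show "?lhs $ i $ j = ?rhs $ i $ j"
        unfolding x_def u_def p_def
        by (simp add: fls_lucas_def sum_component del: lucas_mat.simps)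
    qed
  next
    case 3
    show ?case
    proof (rule sums_mat2I, goal_cases)
      case 1 show ?case
        using fls[of 1 1] by (simp add: fls_lucas_def del: minus_add_distrib)
    next
      case 2 show ?case
        using fls[of 1 2] by (simp add: fls_lucas_def del: minus_add_distrib)
    next
      case 3
      have scale:
        "fls_const (r * s0) * x^3 + fls_const (r * s1) * x^2
          + fls_const (- (r * s2)) * x + fls_const (r * s3)
        =
          fls_const r * (fls_const s0 * x^3 + fls_const s1 * x^2 - fls_const s2 * x + fls_const s3)"
        for r s0 s1 s2 s3 :: real and x
        by (simp add: algebra_simps flip: fls_const_mult_const)
      show ?case
        using fls[of 2 1, unfolded mat2_nth scale] by (simp add: fls_lucas_def)
    next
      case 4
      \<comment> \<open>\<open>F\<close> has this coefficient expanded, the boundary matrix has it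
        factored.\<close>
      have "a^2 * b + 3 * a = (3 + a * b) * a" by (simp add: algebra_simps power2_eq_square)
      then show ?case
        using fls[of 2 2] by (simp add: fls_lucas_def del: minus_add_distrib)
    qed
  next
    case (4 n)
    then obtain m where n: "n = Suc m" by (cases n) auto
    have "(\<Sum>k=0..m. lucas_mat a b k) = (1 / (a * b)) *\<^sub>R ((a * b) *\<^sub>R (\<Sum>k=0..m. lucas_mat a b k))"
      using assms by simp
    then show ?case
      \<comment> \<open>As \<open>n = Suc m\<close>, odd \<open>n\<close> corresponds to even
        \<open>m\<close>, which matches the exponents with the conditionals.\<close>
      unfolding sum_lucas_mat[OF assms] by (simp add: n parity_eps_def del: lucas_mat.simps)
  qed
qed

end
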